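(* Let $Q$ be a Noetherian commutative monoid. A finitely generated $Q$-module $T$ is primary if and only if it has exactly one associated prime ideal.
   Context: $Q$ is a commutative monoid, written additively with identity $0$; Noetherian means equivalently that $Q$ is finitely generated. A $Q$-module is a set $T$ with a left action of $Q$ such that $0\cdot t=t$ and $(q+q')\cdot t=q\cdot(q'\cdot t)$. A submodule is a subset closed under the action; $\langle t_1,\dots,t_r\rangle=\bigcup_i Q\cdot t_i$ is the submodule generated by $t_1,\dots,t_r$, and $T$ is finitely generated if it has this form. An element $\infty\in T$ is nil if $Q\cdot\infty=\{\infty\}$; $N(T)$ is the set of nil elements of $T$. A $Q$-orbit of $T$ is a connected component of the undirected graph with vertex set $T$ and an edge between $s,t$ whenever $q\cdot s=t$ for some $q\in Q$. For $q\in Q$ let $\phi_q:T\to T$, $t\mapsto q\cdot t$. An element $q\in Q$ acts cancellatively on $T$ if $\phi_q$ is injective, and acts nilpotently on $T$ if for each $t\in T$ there is a nonnegative integer $n$ with $(nq)\cdot t\in N(T)$. $T$ is primary if each $q\in Q$ acts either cancellatively or nilpotently on $T$. An ideal of $Q$ is a (possibly empty) subset $I$ with $Q+I\subset I$; an ideal $P\subset Q$ is prime if $Q\setminus P$ is a submonoid of $Q$ (so $P=\emptyset$ is prime). For $P$ prime with $F=Q\setminus P$, the localization $T_P$ is $T\times F$ modulo the equivalence relation $(t,f)\sim(t',f')$ iff $w\cdot f'\cdot t=w\cdot f\cdot t'$ for some $w\in F$; $Q_P$ is a monoid and $T_P$ is a $Q_P$-module. For $t\in T$, $\bar t$ denotes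 its image in $T_P$. Green's preorder on a module sets $t\preceq t'$ whenever $\langle t\rangle\supset\langle t'\rangle$. The kernel of a module homomorphism $\phi$ is the congruence $\ker\phi$ with $t\sim t'$ iff $\phi(t)=\phi(t')$. Let $P\subset Q$ be prime and for $p\in P$ let $\phi_p:T_P\to T_P$ be the action of $p$. An element $w\in T$ is exclusively maximal in a set $A\subset T_P$ if $\bar w$ is the unique maximal element of $A$ under Green's preorder. An element $w\in T$ with non-nil image in $T_P$ is a witness for $P$ if for each generator $p$ of $P$, the class of $\bar w$ under $\ker(\phi_p)$ is not a singleton and $\bar w$ is not exclusively maximal in that class. The prime $P$ is associated to $T$ if $T$ has a witness for $P$, or if $P=\emptyset$ and $T$ has a $Q$-orbit with no nil. *)

theory Defs
  imports "HOL-Algebra.Group"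
begin

text \<open>
  Commutative monoids are those of \<^theory>\<open>HOL-Algebra.Group\<close>, so they are written
  multiplicatively: \<open>\<otimes>\<close> and \<open>\<one>\<close> are the addition and the zero of the additive notation
  customary in this area, and \<open>q [^] n\<close> is the multiple \<open>n q\<close>.  A module is a carrier set \<open>T\<close>,
  possibly empty, with an action that matters only on \<open>carrier Q\<close> and \<open>T\<close>.
\<close>

section \<open>Monoids and their modules\<close>

text \<open>For a commutative monoid, being Noetherian and being finitely generated are equivalent.\<close>

definition noetherian_monoid :: "('q, 'm) monoid_scheme \<Rightarrow> bool" where
  "noetherian_monoid Q \<longleftrightarrow>
     comm_monoid Q \<and>
     (\<exists>A. finite A \<and> A \<subseteq> carrier Q \<and> \<Inter>{H. submonoid H Q \<and> A \<subseteq> H} = carrier Q)"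

locale monoid_module = comm_monoid Q
  for Q :: "('q, 'm) monoid_scheme" (structure) +
  fixes T :: "'t set" and act :: "'q \<Rightarrow> 't \<Rightarrow> 't"
  assumes act_closed [simp]: "\<lbrakk>q \<in> carrier Q; t \<in> T\<rbrakk> \<Longrightarrow> act q t \<in> T"
    and act_one [simp]: "t \<in> T \<Longrightarrow> act \<one> t = t"
    and act_mult: "\<lbrakk>q \<in> carrier Q; q' \<in> carrier Q; t \<in> T\<rbrakk>
      \<Longrightarrow> act (q \<otimes> q') t = act q (act q' t)"

definition module_span :: "('q, 'm) monoid_scheme \<Rightarrow> ('q \<Rightarrow> 't \<Rightarrow> 't) \<Rightarrow> 't set \<Rightarrow> 't set" where
  "module_span Q act S = (\<Union>t\<in>S. {act q t | q. q \<in> carrier Q})"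

definition fin_gen_module ::
  "('q, 'm) monoid_scheme \<Rightarrow> 't set \<Rightarrow> ('q \<Rightarrow> 't \<Rightarrow> 't) \<Rightarrow> bool" where
  "fin_gen_module Q T act \<longleftrightarrow>
     (\<exists>S. finite S \<and> S \<subseteq> T \<and> module_span Q act S = T)"

definition nil_elements ::
  "('q, 'm) monoid_scheme \<Rightarrow> 't set \<Rightarrow> ('q \<Rightarrow> 't \<Rightarrow> 't) \<Rightarrow> 't set" where
  "nil_elements Q T act = {x \<in> T. {act q x | q. q \<in> carrier Q} = {x}}"

definition module_edge ::
  "('q, 'm) monoid_scheme \<Rightarrow> 't set \<Rightarrow> ('q \<Rightarrow> 't \<Rightarrow> 't) \<Rightarrow> 't \<Rightarrow> 't \<Rightarrow> bool" where
  "module_edge Q T act s t \<longleftrightarrow> s \<in> T \<and> t \<in> T \<and> (\<exists>q \<in> carrier Q. act q s = t)"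

text \<open>Connected components: \<^const>\<open>equivclp\<close> forgets the direction of the edges.\<close>

definition module_orbits ::
  "('q, 'm) monoid_scheme \<Rightarrow> 't set \<Rightarrow> ('q \<Rightarrow> 't \<Rightarrow> 't) \<Rightarrow> 't set set" where
  "module_orbits Q T act = {{t \<in> T. equivclp (module_edge Q T act) s t} | s. s \<in> T}"

definition acts_cancellatively :: "'t set \<Rightarrow> ('q \<Rightarrow> 't \<Rightarrow> 't) \<Rightarrow> 'q \<Rightarrow> bool" where
  "acts_cancellatively T act q \<longleftrightarrow> inj_on (act q) T"

definition acts_nilpotently ::
  "('q, 'm) monoid_scheme \<Rightarrow> 't set \<Rightarrow> ('q \<Rightarrow> 't \<Rightarrow> 't) \<Rightarrow> 'q \<Rightarrow> bool" where
  "acts_nilpotently Q T act q \<longleftrightarrow>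
     (\<forall>t \<in> T. \<exists>n::nat. act (q [^]\<^bsub>Q\<^esub> n) t \<in> nil_elements Q T act)"

text \<open>
  ``Either cancellatively or nilpotently'' is exclusive.  This matters only if every element of
  \<open>T\<close> is nil (in particular if \<open>T\<close> is empty): every \<open>q\<close> then acts in both ways, and \<open>T\<close> does
  not count as primary (lemma \<open>primary_module_iff\<close> below).
\<close>

definition primary_module ::
  "('q, 'm) monoid_scheme \<Rightarrow> 't set \<Rightarrow> ('q \<Rightarrow> 't \<Rightarrow> 't) \<Rightarrow> bool" where
  "primary_module Q T act \<longleftrightarrow>
     (\<forall>q \<in> carrier Q. acts_cancellatively T act q \<noteq> acts_nilpotently Q T act q)"

section \<open>Prime ideals and localization\<close>

definition monoid_ideal :: "('q, 'm) monoid_scheme \<Rightarrow> 'q set \<Rightarrow> bool" where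
  "monoid_ideal Q I \<longleftrightarrow> I \<subseteq> carrier Q \<and> (\<forall>q \<in> carrier Q. \<forall>x \<in> I. q \<otimes>\<^bsub>Q\<^esub> x \<in> I)"

definition prime_monoid_ideal :: "('q, 'm) monoid_scheme \<Rightarrow> 'q set \<Rightarrow> bool" where
  "prime_monoid_ideal Q P \<longleftrightarrow> monoid_ideal Q P \<and> submonoid (carrier Q - P) Q"

text \<open>In the following, \<open>F\<close> is the complement of a prime ideal, and the pair \<open>(t, f)\<close> stands for
  the fraction with numerator \<open>t\<close> and denominator \<open>f\<close>.\<close>

definition loc_rel :: "'t set \<Rightarrow> ('q \<Rightarrow> 't \<Rightarrow> 't) \<Rightarrow> 'q set \<Rightarrow> (('t \<times> 'q) \<times> ('t \<times> 'q)) set" where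
  "loc_rel T act F = {((t, f), (t', f')). t \<in> T \<and> f \<in> F \<and> t' \<in> T \<and> f' \<in> F \<and>
     (\<exists>w \<in> F. act w (act f' t) = act w (act f t'))}"

definition loc_class :: "'t set \<Rightarrow> ('q \<Rightarrow> 't \<Rightarrow> 't) \<Rightarrow> 'q set \<Rightarrow> 't \<Rightarrow> 'q \<Rightarrow> ('t \<times> 'q) set" where
  "loc_class T act F t f = loc_rel T act F `` {(t, f)}"

definition loc_carrier :: "'t set \<Rightarrow> ('q \<Rightarrow> 't \<Rightarrow> 't) \<Rightarrow> 'q set \<Rightarrow> ('t \<times> 'q) set set" where
  "loc_carrier T act F = (T \<times> F) // loc_rel T act F"

text \<open>The action of fractions of \<open>Q\<close> on fractions of \<open>T\<close>, defined on representatives; see lemma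
  \<open>loc_act_class\<close> for its value on classes.  The monoid \<open>Q\<close> is localized as a module over itself.\<close>

definition loc_act :: "('q, 'm) monoid_scheme \<Rightarrow> 't set \<Rightarrow> ('q \<Rightarrow> 't \<Rightarrow> 't) \<Rightarrow> 'q set \<Rightarrow>
    ('q \<times> 'q) set \<Rightarrow> ('t \<times> 'q) set \<Rightarrow> ('t \<times> 'q) set" where
  "loc_act Q T act F X Y =
     (\<Union>(q, f) \<in> X. \<Union>(t, g) \<in> Y. loc_class T act F (act q t) (f \<otimes>\<^bsub>Q\<^esub> g))"

definition loc_monoid :: "('q, 'm) monoid_scheme \<Rightarrow> 'q set \<Rightarrow> ('q \<times> 'q) set monoid" where
  "loc_monoid Q F =
     \<lparr>carrier = loc_carrier (carrier Q) (mult Q) F,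
      mult = loc_act Q (carrier Q) (mult Q) F,
      one = loc_class (carrier Q) (mult Q) F \<one>\<^bsub>Q\<^esub> \<one>\<^bsub>Q\<^esub>\<rparr>"

section \<open>Witnesses and associated primes\<close>

definition green_le ::
  "('q, 'm) monoid_scheme \<Rightarrow> ('q \<Rightarrow> 't \<Rightarrow> 't) \<Rightarrow> 't \<Rightarrow> 't \<Rightarrow> bool" where
  "green_le Q act t t' \<longleftrightarrow> module_span Q act {t'} \<subseteq> module_span Q act {t}"

definition green_maximal ::
  "('q, 'm) monoid_scheme \<Rightarrow> ('q \<Rightarrow> 't \<Rightarrow> 't) \<Rightarrow> 't set \<Rightarrow> 't \<Rightarrow> bool" where
  "green_maximal Q act A x \<longleftrightarrow> x \<in> A \<and> (\<forall>y \<in> A. green_le Q act x y \<longrightarrow> green_le Q act y x)"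

text \<open>Uniqueness is as an element, not up to the equivalence induced by the preorder.\<close>

definition exclusively_maximal ::
  "('q, 'm) monoid_scheme \<Rightarrow> ('q \<Rightarrow> 't \<Rightarrow> 't) \<Rightarrow> 't set \<Rightarrow> 't \<Rightarrow> bool" where
  "exclusively_maximal Q act A x \<longleftrightarrow>
     green_maximal Q act A x \<and> (\<forall>y. green_maximal Q act A y \<longrightarrow> y = x)"

definition map_ker :: "'t set \<Rightarrow> ('t \<Rightarrow> 'u) \<Rightarrow> ('t \<times> 't) set" where
  "map_ker M \<phi> = {(s, t). s \<in> M \<and> t \<in> M \<and> \<phi> s = \<phi> t}"

text \<open>The condition on a single \<open>p\<close> in the definition of a witness, for a module \<open>M\<close> over \<open>R\<close>
  that will be the localization.\<close>

definition witness_cond ::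
  "('q, 'm) monoid_scheme \<Rightarrow> 't set \<Rightarrow> ('q \<Rightarrow> 't \<Rightarrow> 't) \<Rightarrow> 'q \<Rightarrow> 't \<Rightarrow> bool" where
  "witness_cond R M act p x \<longleftrightarrow>
     (let A = map_ker M (act p) `` {x} in
        \<not> is_singleton A \<and> \<not> exclusively_maximal R act A x)"

text \<open>
  The condition is imposed on the members of some set \<open>G\<close> of generators of the ideal \<open>P\<close>; which
  one is immaterial (lemma \<open>is_witness_iff\<close> below).
\<close>

definition is_witness ::
  "('q, 'm) monoid_scheme \<Rightarrow> 't set \<Rightarrow> ('q \<Rightarrow> 't \<Rightarrow> 't) \<Rightarrow> 'q set \<Rightarrow> 't \<Rightarrow> bool" where
  "is_witness Q T act P w \<longleftrightarrow>
     (let F = carrier Q - P;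
          QP = loc_monoid Q F;
          TP = loc_carrier T act F;
          actP = loc_act Q T act F;
          w' = loc_class T act F w \<one>\<^bsub>Q\<^esub>
      in w \<in> T \<and> w' \<notin> nil_elements QP TP actP \<and>
         (\<exists>G \<subseteq> carrier Q. module_span Q (mult Q) G = P \<and>
            (\<forall>p \<in> G. witness_cond QP TP actP (loc_class (carrier Q) (mult Q) F p \<one>\<^bsub>Q\<^esub>) w')))"

definition associated_prime ::
  "('q, 'm) monoid_scheme \<Rightarrow> 't set \<Rightarrow> ('q \<Rightarrow> 't \<Rightarrow> 't) \<Rightarrow> 'q set \<Rightarrow> bool" where
  "associated_prime Q T act P \<longleftrightarrow>
     prime_monoid_ideal Q P \<and>
     ((\<exists>w. is_witness Q T act P w) \<or>
      P = {} \<and> (\<exists>O' \<in> module_orbits Q T act. O' \<inter> nil_elements Q T act = {}))"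

section \<open>Consistency of the definitions\<close>

context monoid_module
begin

lemma act_lcomm:
  assumes "q \<in> carrier Q" "q' \<in> carrier Q" "t \<in> T"
  shows "act q (act q' t) = act q' (act q t)"
  using act_mult[OF assms] act_mult[OF assms(2,1,3)] m_comm assms by simp

lemma act_nil:
  assumes "x \<in> nil_elements Q T act" "q \<in> carrier Q"
  shows "act q x = x"
  using assms by (auto simp: nil_elements_def)

lemma primary_module_iff:
  "primary_module Q T act \<longleftrightarrow>
     (\<forall>q \<in> carrier Q. acts_cancellatively T act q \<or> acts_nilpotently Q T act q) \<and>
     nil_elements Q T act \<noteq> T"
proof -
  have both: "nil_elements Q T act = T"
    if q: "q \<in> carrier Q" and c: "acts_cancellatively T act q" and n: "acts_nilpotently Q T act q"
    for q
  proof -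
    have "t \<in> nil_elements Q T act" if t: "t \<in> T" for t
    proof -
      obtain n :: nat where n: "act (q [^] n) t \<in> nil_elements Q T act"
        using n t unfolding acts_nilpotently_def by blast
      define z where "z = act (q [^] n) t"
      have z: "z \<in> nil_elements Q T act" "z \<in> T" using n q t by (auto simp: z_def)
      have inj: "inj_on (act (q [^] k)) T" for k :: nat
      proof (induction k)
        case (Suc k)
        show ?case
        proof (rule inj_onI)
          fix x y assume xy: "x \<in> T" "y \<in> T" "act (q [^] Suc k) x = act (q [^] Suc k) y"
          then have "act (q [^] k) (act q x) = act (q [^] k) (act q y)"
            using q by (simp add: act_mult)
          then have "act q x = act q y" using Suc xy q by (auto dest: inj_onD)
          then show "x = y" using c xy unfolding acts_cancellatively_def by (auto dest: inj_onD)
        qed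
      qed (auto intro: inj_onI)
      have "act (q [^] n) t = act (q [^] n) z"
        using act_nil[OF z(1)] q by (simp add: z_def[symmetric])
      then have "t = z" using inj[of n] t z by (auto dest: inj_onD)
      then show ?thesis using z by simp
    qed
    then show ?thesis by (auto simp: nil_elements_def)
  qed
  have all: "acts_cancellatively T act \<one> \<and> acts_nilpotently Q T act \<one>"
    if "nil_elements Q T act = T"
    using that by (auto simp: acts_cancellatively_def acts_nilpotently_def inj_on_def)
  show ?thesis
    unfolding primary_module_def using both all one_closed by blast
qed

lemma green_le_iff:
  assumes "x \<in> T" "y \<in> T"
  shows "green_le Q act x y \<longleftrightarrow> (\<exists>q \<in> carrier Q. y = act q x)"
proof
  assume "green_le Q act x y"
  moreover have "y \<in> module_span Q act {y}"
    using act_one[OF assms(2)] one_closed unfolding module_span_def by force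
  ultimately show "\<exists>q \<in> carrier Q. y = act q x" by (auto simp: green_le_def module_span_def)
next
  assume "\<exists>q \<in> carrier Q. y = act q x"
  then obtain q where q: "q \<in> carrier Q" "y = act q x" by blast
  have "act r y = act (r \<otimes> q) x" if "r \<in> carrier Q" for r
    using q that assms by (simp add: act_mult)
  then show "green_le Q act x y"
    using q by (fastforce simp: green_le_def module_span_def)
qed

lemma witness_cond_mult:
  assumes G: "G \<subseteq> carrier Q" and cond: "\<And>g. g \<in> G \<Longrightarrow> witness_cond Q T act g x"
    and dich: "\<And>r. r \<in> carrier Q \<Longrightarrow> r \<in> Units Q \<or> (\<exists>g \<in> G. \<exists>s \<in> carrier Q. r = g \<otimes> s)"
    and x: "x \<in> T" and p: "p \<in> G" and q: "q \<in> carrier Q"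
  shows "witness_cond Q T act (p \<otimes> q) x"
proof -
  define K where "K r = map_ker T (act r) `` {x}" for r
  have K: "y \<in> K r \<longleftrightarrow> y \<in> T \<and> act r y = act r x" for y r
    using x by (auto simp: K_def map_ker_def)
  have xK: "x \<in> K r" for r using x K by simp
  have cond': "(\<exists>y \<in> K g. y \<noteq> x) \<and> \<not> exclusively_maximal Q act (K g) x" if "g \<in> G" for g
    using cond[OF that] xK[of g] unfolding witness_cond_def Let_def K_def[symmetric]
    by (auto simp: is_singleton_def)
  have pc: "p \<in> carrier Q" using p G by blast
  have nofix: "act e x \<noteq> x" if e: "e = g \<otimes> s" "g \<in> G" "s \<in> carrier Q" for e g s
  proof
    assume fix': "act e x = x"
    have g: "g \<in> carrier Q" using e G by blast
    have ec: "e \<in> carrier Q" using e g by simp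
    have ev: "act e v = x" if v: "v \<in> K g" for v
    proof -
      have "act e v = act s (act g v)"
        using e g v K by (metis act_mult m_comm)
      also have "\<dots> = act s (act g x)" using v K by simp
      also have "\<dots> = act e x" using e g x by (metis act_mult m_comm)
      finally show ?thesis using fix' by simp
    qed
    have same: "v = x" if v: "v \<in> K g" and le: "green_le Q act x v" for v
    proof -
      have vT: "v \<in> T" using v K by blast
      obtain r where r: "r \<in> carrier Q" "v = act r x" using le x vT green_le_iff by blast
      have "act e v = act r (act e x)" using r x ec act_lcomm by simp
      then show ?thesis using fix' r ev[OF v] by simp
    qed
    have below: "green_le Q act v x" if v: "v \<in> K g" for v
      using ev[OF v] ec v K x green_le_iff by metis
    have "green_maximal Q act (K g) x"
      using same xK below unfolding green_maximal_def by blast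
    moreover have "y = x" if "green_maximal Q act (K g) y" for y
      using that same below xK unfolding green_maximal_def by blast
    ultimately show False using cond'[OF e(2)] unfolding exclusively_maximal_def by blast
  qed
  have sub: "K p \<subseteq> K (p \<otimes> q)"
  proof
    fix y assume y: "y \<in> K p"
    then have "act (p \<otimes> q) y = act q (act p y)" using pc q K by (metis act_mult m_comm)
    also have "\<dots> = act (p \<otimes> q) x" using pc q x y K by (metis act_mult m_comm)
    finally show "y \<in> K (p \<otimes> q)" using y K by simp
  qed
  have "\<not> exclusively_maximal Q act (K (p \<otimes> q)) x"
  proof
    assume ex: "exclusively_maximal Q act (K (p \<otimes> q)) x"
    then have mx: "green_maximal Q act (K (p \<otimes> q)) x" by (simp add: exclusively_maximal_def)
    then have "green_maximal Q act (K p) x"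
      using sub xK unfolding green_maximal_def by blast
    then obtain v where v: "green_maximal Q act (K p) v" "v \<noteq> x"
      using cond'[OF p] unfolding exclusively_maximal_def by blast
    have vK: "v \<in> K p" using v by (simp add: green_maximal_def)
    have vT: "v \<in> T" using vK K by blast
    have "\<not> green_maximal Q act (K (p \<otimes> q)) v"
      using ex v unfolding exclusively_maximal_def by blast
    then obtain u where u: "u \<in> K (p \<otimes> q)" "green_le Q act v u" "\<not> green_le Q act u v"
      using vK sub unfolding green_maximal_def by blast
    have uT: "u \<in> T" using u K by blast
    obtain a where a: "a \<in> carrier Q" "u = act a v" using u vT uT green_le_iff by blast
    have "act (p \<otimes> q) (act a x) = act a (act q (act p x))"
      using a pc q x by (simp add: act_mult act_lcomm)
    also have "\<dots> = act a (act q (act p v))" using vK K by simp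
    also have "\<dots> = act (p \<otimes> q) u" using a pc q vT by (simp add: act_mult act_lcomm)
    also have "\<dots> = act (p \<otimes> q) x" using u K by simp
    finally have "act a x \<in> K (p \<otimes> q)" using K a x by simp
    moreover have "green_le Q act x (act a x)" using a x green_le_iff by auto
    ultimately have "green_le Q act (act a x) x" using mx unfolding green_maximal_def by blast
    then obtain b where b: "b \<in> carrier Q" "x = act b (act a x)"
      using a x green_le_iff by auto
    then have fixba: "act (b \<otimes> a) x = x" using a x by (simp add: act_mult)
    show False
    proof (cases "b \<otimes> a \<in> Units Q")
      case True
      then obtain c where c: "c \<in> carrier Q" "c \<otimes> (b \<otimes> a) = \<one>" unfolding Units_def by blast
      have "act (c \<otimes> b) u = act (c \<otimes> (b \<otimes> a)) v"
        using a(1) b(1) c(1) vT by (simp add: a(2) act_mult)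
      also have "\<dots> = v" using c vT by simp
      finally have "v = act (c \<otimes> b) u" by (rule sym)
      then have "green_le Q act u v" using uT vT b c green_le_iff by blast
      with u show False by blast
    next
      case False
      then obtain g s where "g \<in> G" "s \<in> carrier Q" "b \<otimes> a = g \<otimes> s"
        using dich[of "b \<otimes> a"] a b by auto
      then show False using nofix fixba by blast
    qed
  qed
  moreover have "\<not> is_singleton (K (p \<otimes> q))"
    using cond'[OF p] sub xK[of "p \<otimes> q"] unfolding is_singleton_def by (metis singletonD subsetD)
  ultimately show ?thesis unfolding witness_cond_def Let_def K_def by simp
qed

end

locale module_loc = monoid_module Q T act
  for Q :: "('q, 'm) monoid_scheme" (structure) and T :: "'t set" and act +
  fixes F
  assumes submonoid_F: "submonoid F Q"
begin

lemma F_carrier [simp]: "f \<in> F \<Longrightarrow> f \<in> carrier Q"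
  and F_mult [simp]: "\<lbrakk>f \<in> F; g \<in> F\<rbrakk> \<Longrightarrow> f \<otimes> g \<in> F"
  and F_one [simp]: "\<one> \<in> F"
  using submonoid_F by (auto simp: submonoid_def)

lemma equiv_loc_rel: "equiv (T \<times> F) (loc_rel T act F)"
proof (rule equivI)
  show "loc_rel T act F \<subseteq> (T \<times> F) \<times> (T \<times> F)" by (auto simp: loc_rel_def)
  show "refl_on (T \<times> F) (loc_rel T act F)"
    by (auto simp: refl_on_def loc_rel_def)
  show "sym (loc_rel T act F)"
    unfolding loc_rel_def by (rule symI) (auto, metis)
  show "trans (loc_rel T act F)"
  proof (rule transI)
    fix x y z assume "(x, y) \<in> loc_rel T act F" "(y, z) \<in> loc_rel T act F"
    then obtain t f t' f' t'' f'' w w' where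
      e: "x = (t, f)" "y = (t', f')" "z = (t'', f'')"
      and m: "t \<in> T" "f \<in> F" "t' \<in> T" "f' \<in> F" "t'' \<in> T" "f'' \<in> F" "w \<in> F" "w' \<in> F"
      and 1: "act w (act f' t) = act w (act f t')"
      and 2: "act w' (act f'' t') = act w' (act f' t'')"
      unfolding loc_rel_def by auto
    have "act (w \<otimes> w' \<otimes> f') (act f'' t) = act w' (act f'' (act w (act f' t)))"
      using m by (simp add: act_mult act_lcomm)
    also have "\<dots> = act w (act f (act w' (act f'' t')))"
      unfolding 1 using m by (simp add: act_lcomm)
    also have "\<dots> = act (w \<otimes> w' \<otimes> f') (act f t'')"
      unfolding 2 using m by (simp add: act_mult act_lcomm)
    finally show "(x, z) \<in> loc_rel T act F"
      unfolding e loc_rel_def using m by auto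
  qed
qed

lemma loc_class_eq_iff:
  assumes "t \<in> T" "f \<in> F" "t' \<in> T" "f' \<in> F"
  shows "loc_class T act F t f = loc_class T act F t' f' \<longleftrightarrow>
    (\<exists>w \<in> F. act w (act f' t) = act w (act f t'))"
  using eq_equiv_class_iff[OF equiv_loc_rel, of "(t, f)" "(t', f')"] assms
  by (simp add: loc_class_def loc_rel_def)

lemma loc_class_in [simp]: "\<lbrakk>t \<in> T; f \<in> F\<rbrakk> \<Longrightarrow> loc_class T act F t f \<in> loc_carrier T act F"
  by (auto simp: loc_class_def loc_carrier_def intro!: quotientI)

lemma loc_carrierE:
  assumes "x \<in> loc_carrier T act F"
  obtains t f where "t \<in> T" "f \<in> F" "x = loc_class T act F t f"
  using assms unfolding loc_carrier_def loc_class_def by (auto elim!: quotientE)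

end

lemma (in comm_monoid) self_module: "monoid_module Q (carrier Q) (mult Q)"
  if "Q = G" for Q
  using that by (simp add: monoid_module_def monoid_module_axioms_def comm_monoid_axioms m_assoc)

context module_loc
begin

interpretation Q: module_loc Q "carrier Q" "mult Q" F
  using self_module submonoid_F by (simp add: module_loc_def module_loc_axioms_def)

lemma loc_act_class:
  assumes "q \<in> carrier Q" "f \<in> F" "t \<in> T" "g \<in> F"
  shows "loc_act Q T act F (loc_class (carrier Q) (mult Q) F q f) (loc_class T act F t g) =
    loc_class T act F (act q t) (f \<otimes> g)"
proof -
  let ?h = "\<lambda>(q, f) (t, g). loc_class T act F (act q t) (f \<otimes> g)"
  have "congruent2 (loc_rel (carrier Q) (mult Q) F) (loc_rel T act F) ?h"
  proof (rule congruent2I')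
    fix x x' y y'
    assume "(x, x') \<in> loc_rel (carrier Q) (mult Q) F" "(y, y') \<in> loc_rel T act F"
    then obtain q f q' f' w t g t' g' v where
      e: "x = (q, f)" "x' = (q', f')" "y = (t, g)" "y' = (t', g')"
      and m: "q \<in> carrier Q" "f \<in> F" "q' \<in> carrier Q" "f' \<in> F" "w \<in> F"
        "t \<in> T" "g \<in> F" "t' \<in> T" "g' \<in> F" "v \<in> F"
      and 1: "w \<otimes> (f' \<otimes> q) = w \<otimes> (f \<otimes> q')" and 2: "act v (act g' t) = act v (act g t')"
      unfolding loc_rel_def by auto
    have "act (w \<otimes> v) (act (f' \<otimes> g') (act q t)) = act (w \<otimes> (f' \<otimes> q)) (act v (act g' t))"
      using m by (simp add: act_mult act_lcomm)
    also have "\<dots> = act (w \<otimes> v) (act (f \<otimes> g) (act q' t'))"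
      unfolding 1 2 using m by (simp add: act_mult act_lcomm)
    finally show "?h x y = ?h x' y'" unfolding e using m by (auto simp: loc_class_eq_iff)
  qed
  from UN_equiv_class2[OF Q.equiv_loc_rel equiv_loc_rel this, of "(q, f)" "(t, g)"] assms
  show ?thesis by (simp add: loc_act_def loc_class_def case_prod_unfold)
qed

end

context module_loc
begin

interpretation Q: module_loc Q "carrier Q" "mult Q" F
  using self_module submonoid_F by (simp add: module_loc_def module_loc_axioms_def)

lemma loc_mult_class:
  assumes "q \<in> carrier Q" "f \<in> F" "t \<in> carrier Q" "g \<in> F"
  shows "loc_act Q (carrier Q) (mult Q) F
      (loc_class (carrier Q) (mult Q) F q f) (loc_class (carrier Q) (mult Q) F t g) =
    loc_class (carrier Q) (mult Q) F (q \<otimes> t) (f \<otimes> g)"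
  using Q.loc_act_class assms by simp

lemma comm_monoid_loc: "comm_monoid (loc_monoid Q F)"
  by (rule comm_monoidI)
    (auto simp: loc_monoid_def loc_mult_class m_ac elim!: Q.loc_carrierE)

lemma monoid_module_loc:
  "monoid_module (loc_monoid Q F) (loc_carrier T act F) (loc_act Q T act F)"
  unfolding monoid_module_def monoid_module_axioms_def
  using comm_monoid_loc
  by (auto simp: loc_monoid_def loc_mult_class loc_act_class act_mult m_assoc
      elim!: Q.loc_carrierE loc_carrierE)

lemma loc_numerator_cases:
  assumes "r \<in> carrier (loc_monoid Q F)" and P: "carrier Q - F = module_span Q (mult Q) G"
    and G: "G \<subseteq> carrier Q"
  shows "r \<in> Units (loc_monoid Q F) \<or>
    (\<exists>g \<in> (\<lambda>p. loc_class (carrier Q) (mult Q) F p \<one>) ` G.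
       \<exists>s \<in> carrier (loc_monoid Q F). r = g \<otimes>\<^bsub>loc_monoid Q F\<^esub> s)"
proof -
  from assms(1) have "r \<in> loc_carrier (carrier Q) (mult Q) F" by (simp add: loc_monoid_def)
  then obtain q f where r: "q \<in> carrier Q" "f \<in> F" "r = loc_class (carrier Q) (mult Q) F q f"
    by (rule Q.loc_carrierE)
  show ?thesis
  proof (cases "q \<in> F")
    case True
    have one: "loc_class (carrier Q) (mult Q) F (f \<otimes> q) (f \<otimes> q) =
        loc_class (carrier Q) (mult Q) F \<one> \<one>"
      using True r(2) by (subst Q.loc_class_eq_iff) auto
    let ?s = "loc_class (carrier Q) (mult Q) F f q"
    have "r \<otimes>\<^bsub>loc_monoid Q F\<^esub> ?s = \<one>\<^bsub>loc_monoid Q F\<^esub>"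
      "?s \<otimes>\<^bsub>loc_monoid Q F\<^esub> r = \<one>\<^bsub>loc_monoid Q F\<^esub>"
      "?s \<in> carrier (loc_monoid Q F)"
      using r True by (simp_all add: loc_monoid_def loc_mult_class one m_comm[of q f])
    then have "r \<in> Units (loc_monoid Q F)"
      using assms(1) unfolding Units_def by blast
    then show ?thesis ..
  next
    case False
    with r P obtain g s where gs: "g \<in> G" "s \<in> carrier Q" "q = s \<otimes> g"
      unfolding module_span_def by blast
    then have "r = loc_class (carrier Q) (mult Q) F g \<one> \<otimes>\<^bsub>loc_monoid Q F\<^esub>
        loc_class (carrier Q) (mult Q) F s f"
      using r G by (auto simp: loc_monoid_def loc_mult_class m_comm subset_iff)
    moreover have "loc_class (carrier Q) (mult Q) F s f \<in> carrier (loc_monoid Q F)"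
      using gs r by (simp add: loc_monoid_def)
    ultimately show ?thesis using gs(1) by blast
  qed
qed

end

theorem (in monoid_module) is_witness_iff:
  assumes P: "prime_monoid_ideal Q P" and G: "G \<subseteq> carrier Q" "module_span Q (mult Q) G = P"
  defines "F \<equiv> carrier Q - P"
  shows "is_witness Q T act P w \<longleftrightarrow>
    w \<in> T \<and>
    loc_class T act F w \<one> \<notin>
      nil_elements (loc_monoid Q F) (loc_carrier T act F) (loc_act Q T act F) \<and>
    (\<forall>p \<in> G. witness_cond (loc_monoid Q F) (loc_carrier T act F) (loc_act Q T act F)
       (loc_class (carrier Q) (mult Q) F p \<one>) (loc_class T act F w \<one>))"
proof -
  interpret module_loc Q T act F
    using P monoid_module_axioms
    by (simp add: module_loc_def module_loc_axioms_def F_def prime_monoid_ideal_def)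
  interpret Q: module_loc Q "carrier Q" "mult Q" F
    using self_module submonoid_F by (simp add: module_loc_def module_loc_axioms_def)
  interpret L: monoid_module "loc_monoid Q F" "loc_carrier T act F" "loc_act Q T act F"
    by (rule monoid_module_loc)
  let ?c = "\<lambda>p. loc_class (carrier Q) (mult Q) F p \<one>"
  let ?W = "\<lambda>p. witness_cond (loc_monoid Q F) (loc_carrier T act F) (loc_act Q T act F)
       (?c p) (loc_class T act F w \<one>)"
  have PF: "carrier Q - F = P"
    using P unfolding F_def prime_monoid_ideal_def monoid_ideal_def by blast
  have transfer: "?W p"
    if G': "G' \<subseteq> carrier Q" "module_span Q (mult Q) G' = P" "\<forall>p \<in> G'. ?W p"
      and w: "w \<in> T" and p: "p \<in> G" for G' p
  proof -
    have "p \<in> P" using G p unfolding module_span_def by (force intro: exI[of _ \<one>])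
    then obtain g s where gs: "g \<in> G'" "s \<in> carrier Q" "p = s \<otimes> g"
      using G'(2) unfolding module_span_def by blast
    have "?c p = ?c g \<otimes>\<^bsub>loc_monoid Q F\<^esub> ?c s"
      using gs G' by (auto simp: loc_monoid_def loc_mult_class m_comm subset_iff)
    moreover have "witness_cond (loc_monoid Q F) (loc_carrier T act F) (loc_act Q T act F)
        (?c g \<otimes>\<^bsub>loc_monoid Q F\<^esub> ?c s) (loc_class T act F w \<one>)"
    proof (rule L.witness_cond_mult[of "?c ` G'"])
      show "?c ` G' \<subseteq> carrier (loc_monoid Q F)" "?c s \<in> carrier (loc_monoid Q F)"
        using G'(1) gs by (auto simp: loc_monoid_def)
      show "r \<in> Units (loc_monoid Q F) \<or> (\<exists>g \<in> ?c ` G'. \<exists>s \<in> carrier (loc_monoid Q F).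
          r = g \<otimes>\<^bsub>loc_monoid Q F\<^esub> s)" if "r \<in> carrier (loc_monoid Q F)" for r
        using loc_numerator_cases[OF that _ G'(1)] PF G'(2) by simp
    qed (use G'(3) gs(1) w in auto)
    ultimately show ?thesis by simp
  qed
  show ?thesis
    unfolding is_witness_def Let_def F_def[symmetric] using transfer G by blast
qed

end

theory Submission
  imports Defs
begin

text \<open>
  The associated primes control how a single element \<open>q\<close> of \<open>Q\<close> acts on \<open>T\<close>, just as for modules
  over Noetherian rings: \<open>q\<close> lies in some associated prime if and only if it does not act
  cancellatively, and in all of them if and only if it acts nilpotently (lemmas
  \<open>in_some_associated_prime_iff\<close> and \<open>in_all_associated_primes_iff\<close>).  If there is exactly one
  associated prime \<open>P\<close>, then ``some'' and ``all'' coincide, so elements of \<open>P\<close> act nilpotently and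
  all others cancellatively.  Conversely, if \<open>T\<close> is primary, then every associated prime must be
  the set of the elements that act nilpotently, and one exists because \<open>\<one>\<close> does not act
  nilpotently.

  That associated primes avoid cancellative elements and contain nilpotent ones is read off from
  the definition.  The substance is to produce associated primes.  As in the classical argument, a
  prime is found as a maximal annihilator: either of a pair \<open>a \<noteq> b\<close>, namely
  \<open>{r. r a = r b}\<close>, or of an element modulo nil elements and modulo powers of \<open>q\<close>
  (lemma \<open>colon_closed_family_has_prime\<close>).  If this prime \<open>P\<close> is empty, it arises from an element
  of which no multiple is nil, and the orbit of that element has no nil.  Otherwise the localization
  at \<open>P\<close> contains two distinct elements \<open>x\<close> and \<open>y\<close> that every element of \<open>P\<close> identifies, and one
  of the two is a witness (lemma \<open>identified_pair_has_witness\<close>).  For \<open>x\<close> can only fail to be one by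
  being nil or exclusively maximal in a class that contains \<open>y\<close>, and either way some element of the
  monoid sends both \<open>x\<close> and \<open>y\<close> to \<open>x\<close>.  If both failed, a second one would send both to \<open>y\<close>, but
  two such maps do not commute.
\<close>

section \<open>Prime ideals from colon-closed families\<close>

text \<open>
  In place of a member that is maximal under inclusion, the proof takes a member whose trace on a
  finite set \<open>A\<close> of generators of the monoid has maximal size.  All larger members have the same
  trace, and since their colon ideals are again such members, an element lies in one of them only if
  it has a factor in that trace.  So the chosen member \<open>J\<close> coincides with its colon ideals
  \<open>{s. s r \<in> J}\<close> for \<open>r\<close> outside \<open>J\<close>, which means that it is prime.
\<close>

lemma colon_closed_family_has_prime:
  fixes Q (structure)
  assumes noeth: "noetherian_monoid Q" and I: "I \<in> \<I>"
    and ideal: "\<And>I. I \<in> \<I> \<Longrightarrow> monoid_ideal Q I"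
    and proper: "\<And>I. I \<in> \<I> \<Longrightarrow> \<one> \<notin> I"
    and colon: "\<And>I r. \<lbrakk>I \<in> \<I>; r \<in> carrier Q; r \<notin> I\<rbrakk> \<Longrightarrow> {s \<in> carrier Q. s \<otimes> r \<in> I} \<in> \<I>"
  obtains P where "P \<in> \<I>" "I \<subseteq> P" "prime_monoid_ideal Q P"
proof -
  interpret comm_monoid Q using noeth by (simp add: noetherian_monoid_def)
  obtain A where A: "finite A" "A \<subseteq> carrier Q"
    and gen: "\<Inter>{H. submonoid H Q \<and> A \<subseteq> H} = carrier Q"
    using noeth unfolding noetherian_monoid_def by blast
  have "card (K \<inter> A) < Suc (card A)" for K
    using A(1) by (simp add: less_Suc_eq_le card_mono)
  then obtain J where J: "J \<in> \<I>" "I \<subseteq> J"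
    and max: "\<And>K. \<lbrakk>K \<in> \<I>; I \<subseteq> K\<rbrakk> \<Longrightarrow> card (K \<inter> A) \<le> card (J \<inter> A)"
    using ex_has_greatest_nat[of "\<lambda>K. K \<in> \<I> \<and> I \<subseteq> K" I "\<lambda>K. card (K \<inter> A)" "Suc (card A)"] I
    by blast
  have trace: "K \<inter> A = J \<inter> A" if "K \<in> \<I>" "J \<subseteq> K" for K
    using card_seteq[of "K \<inter> A" "J \<inter> A"] max[of K] that J(2) A(1) by blast
  have above: "J \<subseteq> {s \<in> carrier Q. s \<otimes> r \<in> K}" if "K \<in> \<I>" "J \<subseteq> K" "r \<in> carrier Q" for K r
    using ideal[OF that(1)] ideal[OF J(1)] that unfolding monoid_ideal_def
    by (auto simp: m_comm[of _ r] subset_iff)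
  define H where "H = {s \<in> carrier Q. s \<in> J \<or> (\<forall>K \<in> \<I>. J \<subseteq> K \<longrightarrow> s \<notin> K)}"
  have "submonoid H Q"
  proof
    show "H \<subseteq> carrier Q" by (auto simp: H_def)
    show "\<one> \<in> H" using proper by (auto simp: H_def)
    fix s s' assume s: "s \<in> H" "s' \<in> H"
    have c: "s \<in> carrier Q" "s' \<in> carrier Q" using s by (auto simp: H_def)
    show "s \<otimes> s' \<in> H"
    proof (cases "s \<in> J \<or> s' \<in> J")
      case True
      then have "s \<otimes> s' \<in> J"
        using ideal[OF J(1)] c m_comm[of s s'] unfolding monoid_ideal_def by metis
      then show ?thesis using c by (simp add: H_def)
    next
      case False
      have "s \<otimes> s' \<notin> K" if K: "K \<in> \<I>" "J \<subseteq> K" for K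
      proof
        assume "s \<otimes> s' \<in> K"
        moreover have "s' \<notin> K" using s(2) False K by (auto simp: H_def)
        ultimately show False
          using s(1) False colon[OF K(1) c(2)] above[OF K c(2)] c unfolding H_def by blast
      qed
      then show ?thesis using c by (simp add: H_def)
    qed
  qed
  moreover have "A \<subseteq> H" using A(2) trace by (auto simp: H_def)
  ultimately have "carrier Q \<subseteq> H" using gen by blast
  then have outside: "s \<notin> K" if "s \<in> carrier Q - J" "K \<in> \<I>" "J \<subseteq> K" for s K
    using that by (auto simp: H_def)
  have "submonoid (carrier Q - J) Q"
  proof
    show "\<one> \<in> carrier Q - J" using proper[OF J(1)] by simp
    fix s r assume "s \<in> carrier Q - J" "r \<in> carrier Q - J"
    then show "s \<otimes> r \<in> carrier Q - J"
      using outside[of s "{s \<in> carrier Q. s \<otimes> r \<in> J}"] colon[OF J(1)] above[OF J(1)] by auto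
  qed auto
  then have "prime_monoid_ideal Q J" using ideal J(1) by (simp add: prime_monoid_ideal_def)
  with J that show thesis by blast
qed

section \<open>Witnesses from pairs of elements\<close>

context monoid_module
begin

lemma nil_elements_iff: "x \<in> nil_elements Q T act \<longleftrightarrow> x \<in> T \<and> (\<forall>q \<in> carrier Q. act q x = x)"
  using act_nil by (auto simp: nil_elements_def intro!: exI[of _ \<one>])

lemma act_in_nil_elements:
  assumes "x \<in> T" "q \<in> carrier Q" "r \<in> carrier Q" "act q x \<in> nil_elements Q T act"
  shows "act q (act r x) \<in> nil_elements Q T act"
  using assms act_lcomm[of q r x] act_nil[OF assms(4)] by simp

text \<open>
  An element that is strictly above \<open>y\<close> in the class is a non-unit multiple of \<open>y\<close>, hence the same
  multiple of \<open>x\<close>; so it lies above \<open>x\<close> as well, and maximality of \<open>x\<close> leads back to \<open>x\<close>.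
\<close>

lemma exclusively_maximal_common_image:
  assumes x: "x \<in> T" and y: "y \<in> T" "y \<noteq> x" and p: "act p x = act p y"
    and dich: "\<And>r. r \<in> carrier Q \<Longrightarrow> r \<in> Units Q \<or> act r x = act r y"
    and ex: "exclusively_maximal Q act (map_ker T (act p) `` {x}) x"
  obtains e where "e \<in> carrier Q" "act e x = x" "act e y = x"
proof -
  define K where "K = map_ker T (act p) `` {x}"
  have yK: "y \<in> K" using x y p by (auto simp: K_def map_ker_def)
  then obtain u where u: "u \<in> K" "green_le Q act y u" "\<not> green_le Q act u y"
    using ex y(2) unfolding exclusively_maximal_def K_def[symmetric] green_maximal_def by blast
  have uT: "u \<in> T" using u(1) by (auto simp: K_def map_ker_def)
  obtain r where r: "r \<in> carrier Q" "u = act r y" using u(2) y(1) uT green_le_iff by blast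
  have "r \<notin> Units Q"
  proof
    assume "r \<in> Units Q"
    then obtain c where c: "c \<in> carrier Q" "c \<otimes> r = \<one>" unfolding Units_def by blast
    then have "y = act c u" using r y(1) act_mult[of c r y] by simp
    then show False using u(3) uT y(1) c(1) green_le_iff by blast
  qed
  with dich[OF r(1)] r(2) have ux: "u = act r x" by simp
  then have "green_le Q act x u" using x uT r(1) green_le_iff by blast
  then have "green_le Q act u x"
    using ex u(1) unfolding exclusively_maximal_def K_def[symmetric] green_maximal_def by blast
  then obtain s where s: "s \<in> carrier Q" "x = act s u" using x uT green_le_iff by blast
  have "act (s \<otimes> r) x = act s (act r x)" "act (s \<otimes> r) y = act s (act r y)"
    using s(1) r(1) x y(1) by (auto simp: act_mult)
  with s(2) r(2) ux have "act (s \<otimes> r) x = x" "act (s \<otimes> r) y = x" by simp_all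
  with s(1) r(1) that show thesis by blast
qed

lemma identified_pair_has_witness:
  assumes x: "x \<in> T" and y: "y \<in> T" and ne: "x \<noteq> y"
    and G: "G \<subseteq> carrier Q" "G \<noteq> {}" and eq: "\<And>p. p \<in> G \<Longrightarrow> act p x = act p y"
    and dich: "\<And>r. r \<in> carrier Q \<Longrightarrow> r \<in> Units Q \<or> (\<exists>g \<in> G. \<exists>s \<in> carrier Q. r = g \<otimes> s)"
  shows "\<exists>w \<in> {x, y}. w \<notin> nil_elements Q T act \<and> (\<forall>p \<in> G. witness_cond Q T act p w)"
proof -
  have fails: "w \<in> nil_elements Q T act \<or>
      (\<exists>p \<in> G. exclusively_maximal Q act (map_ker T (act p) `` {w}) w)"
    if "\<not> (w \<notin> nil_elements Q T act \<and> (\<forall>p \<in> G. witness_cond Q T act p w))"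
      "w \<in> T" "v \<in> T" "w \<noteq> v" and eq: "\<And>p. p \<in> G \<Longrightarrow> act p w = act p v" for w v
  proof -
    have "\<not> is_singleton (map_ker T (act p) `` {w})" if p: "p \<in> G" for p
    proof
      assume "is_singleton (map_ker T (act p) `` {w})"
      then obtain z where "map_ker T (act p) `` {w} = {z}" unfolding is_singleton_def by blast
      moreover have "w \<in> map_ker T (act p) `` {w}" "v \<in> map_ker T (act p) `` {w}"
        using \<open>w \<in> T\<close> \<open>v \<in> T\<close> eq[OF p] by (auto simp: map_ker_def)
      ultimately show False using \<open>w \<noteq> v\<close> by (metis singletonD)
    qed
    with that(1) show ?thesis unfolding witness_cond_def Let_def by blast
  qed
  have dich': "r \<in> Units Q \<or> act r x = act r y" if r: "r \<in> carrier Q" for r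
  proof (cases "r \<in> Units Q")
    case False
    then obtain g s where gs: "g \<in> G" "s \<in> carrier Q" "r = g \<otimes> s" using dich[OF r] by blast
    then have g: "g \<in> carrier Q" "r = s \<otimes> g" using G m_comm by auto
    have "act r x = act s (act g x)" "act r y = act s (act g y)"
      unfolding g(2) using g(1) gs(2) x y by (simp_all add: act_mult)
    then show ?thesis using eq[OF gs(1)] by simp
  qed simp
  have common: "\<exists>e \<in> carrier Q. act e w = w \<and> act e v = w"
    if "\<not> (w \<notin> nil_elements Q T act \<and> (\<forall>p \<in> G. witness_cond Q T act p w))"
      and w: "w \<in> T" and v: "v \<in> T" "v \<noteq> w" and eq: "\<And>p. p \<in> G \<Longrightarrow> act p w = act p v"
      and dich: "\<And>r. r \<in> carrier Q \<Longrightarrow> r \<in> Units Q \<or> act r w = act r v" for w v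
    using fails[OF that(1) w v(1) v(2)[symmetric] eq]
  proof
    assume nil: "w \<in> nil_elements Q T act"
    obtain p where p: "p \<in> G" "p \<in> carrier Q" using G by blast
    then have "act p w = w" "act p v = w" using act_nil[OF nil] eq[OF p(1)] by auto
    with p(2) show ?thesis by blast
  next
    assume "\<exists>p \<in> G. exclusively_maximal Q act (map_ker T (act p) `` {w}) w"
    then obtain p where p: "p \<in> G" "exclusively_maximal Q act (map_ker T (act p) `` {w}) w" ..
    show ?thesis
      using exclusively_maximal_common_image[OF w v eq[OF p(1)] dich p(2)] by blast
  qed
  show ?thesis
  proof (rule ccontr)
    assume "\<not> ?thesis"
    then have no:
      "\<not> (x \<notin> nil_elements Q T act \<and> (\<forall>p \<in> G. witness_cond Q T act p x))"
      "\<not> (y \<notin> nil_elements Q T act \<and> (\<forall>p \<in> G. witness_cond Q T act p y))" by blast+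
    obtain e where e: "e \<in> carrier Q" "act e x = x" "act e y = x"
      using common[OF no(1) x y ne[symmetric] eq dich'] by blast
    have "r \<in> Units Q \<or> act r y = act r x" if "r \<in> carrier Q" for r
      using dich'[OF that] by auto
    then obtain e' where e': "e' \<in> carrier Q" "act e' y = y" "act e' x = y"
      using common[OF no(2) y x ne eq[symmetric]] by blast
    have "act e (act e' x) = act e' (act e x)" using act_lcomm e(1) e'(1) x .
    then show False using e e' ne by simp
  qed
qed

text \<open>
  The conditions on \<open>a\<close> and \<open>b\<close> express, without fractions, that their images in the localization
  are distinct and that every element of \<open>P\<close> identifies these images.
\<close>

lemma associated_prime_if_identified_pair:
  assumes P: "prime_monoid_ideal Q P" "P \<noteq> {}" and a: "a \<in> T" and b: "b \<in> T"
    and ne: "\<And>f. f \<in> carrier Q - P \<Longrightarrow> act f a \<noteq> act f b"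
    and eq: "\<And>p. p \<in> P \<Longrightarrow> \<exists>f \<in> carrier Q - P. act f (act p a) = act f (act p b)"
  shows "associated_prime Q T act P"
proof -
  define F where "F = carrier Q - P"
  interpret module_loc Q T act F
    using P monoid_module_axioms
    by (simp add: module_loc_def module_loc_axioms_def F_def prime_monoid_ideal_def)
  interpret Q: module_loc Q "carrier Q" "mult Q" F
    using self_module submonoid_F by (simp add: module_loc_def module_loc_axioms_def)
  interpret L: monoid_module "loc_monoid Q F" "loc_carrier T act F" "loc_act Q T act F"
    by (rule monoid_module_loc)
  let ?c = "\<lambda>p. loc_class (carrier Q) (mult Q) F p \<one>"
  let ?t = "\<lambda>t. loc_class T act F t \<one>"
  have PQ: "P \<subseteq> carrier Q" and mul: "\<And>q p. \<lbrakk>q \<in> carrier Q; p \<in> P\<rbrakk> \<Longrightarrow> q \<otimes> p \<in> P"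
    using P by (auto simp: prime_monoid_ideal_def monoid_ideal_def)
  have span: "module_span Q (mult Q) P = P"
  proof
    show "P \<subseteq> module_span Q (mult Q) P"
      using PQ unfolding module_span_def by (force intro: exI[of _ \<one>])
  qed (auto simp: module_span_def mul)
  have PF: "carrier Q - F = module_span Q (mult Q) P" using PQ span by (auto simp: F_def)
  have "\<exists>w \<in> {?t a, ?t b}.
      w \<notin> nil_elements (loc_monoid Q F) (loc_carrier T act F) (loc_act Q T act F) \<and>
      (\<forall>p \<in> ?c ` P. witness_cond (loc_monoid Q F) (loc_carrier T act F) (loc_act Q T act F) p w)"
  proof (rule L.identified_pair_has_witness)
    show "?t a \<in> loc_carrier T act F" "?t b \<in> loc_carrier T act F" using a b by simp_all
    show "?t a \<noteq> ?t b" using ne a b by (auto simp: loc_class_eq_iff F_def[symmetric])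
    show "?c ` P \<subseteq> carrier (loc_monoid Q F)" "?c ` P \<noteq> {}"
      using PQ P(2) by (auto simp: loc_monoid_def)
    show "loc_act Q T act F x (?t a) = loc_act Q T act F x (?t b)" if x: "x \<in> ?c ` P" for x
    proof -
      obtain p where p: "p \<in> P" "x = ?c p" using x by blast
      then have pc: "p \<in> carrier Q" using PQ by blast
      then have "loc_class T act F (act p a) \<one> = loc_class T act F (act p b) \<one>"
        using eq[OF p(1)] a b by (subst loc_class_eq_iff) (auto simp: F_def[symmetric])
      then show ?thesis using p(2) pc a b by (simp add: loc_act_class)
    qed
    show "r \<in> Units (loc_monoid Q F) \<or>
        (\<exists>g \<in> ?c ` P. \<exists>s \<in> carrier (loc_monoid Q F). r = g \<otimes>\<^bsub>loc_monoid Q F\<^esub> s)"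
      if "r \<in> carrier (loc_monoid Q F)" for r
      using loc_numerator_cases[OF that PF PQ] .
  qed
  then obtain w where "w \<in> {a, b}" "is_witness Q T act P w"
    unfolding is_witness_iff[OF P(1) PQ span] F_def[symmetric] using a b by blast
  then show ?thesis using P(1) by (auto simp: associated_prime_def)
qed

section \<open>Associated primes and the action of a single element\<close>

text \<open>
  Having a common multiple is a transitive relation because the monoid is commutative, so it
  extends from the edges of the graph to its connected components.
\<close>

lemma connected_have_common_multiple:
  assumes "equivclp (module_edge Q T act) s t" "s \<in> T"
  shows "t \<in> T \<and> (\<exists>q \<in> carrier Q. \<exists>r \<in> carrier Q. act q s = act r t)"
  using assms(1)
proof (induction rule: equivclp_induct)
  case base
  show ?case using assms(2) one_closed by blast
next
  case (step y z)
  then obtain q r where qr: "q \<in> carrier Q" "r \<in> carrier Q" "act q s = act r y" and y: "y \<in> T"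
    by blast
  from step(2) obtain u where u: "u \<in> carrier Q" "act u y = z \<or> act u z = y" and z: "z \<in> T"
    unfolding module_edge_def by blast
  from u(2) show ?case
  proof
    assume "act u y = z"
    then have "act (u \<otimes> q) s = act r z"
      using qr u(1) y assms(2) by (simp add: act_mult act_lcomm[of u r y])
    then show ?thesis using qr u(1) z by blast
  next
    assume "act u z = y"
    then have "act q s = act (r \<otimes> u) z" using qr u(1) z by (simp add: act_mult)
    then show ?thesis using qr u(1) z by blast
  qed
qed

lemma cancellative_notin_associated_prime:
  assumes ass: "associated_prime Q T act P" and q: "q \<in> P"
  shows "\<not> acts_cancellatively T act q"
proof
  assume canc: "acts_cancellatively T act q"
  have P: "prime_monoid_ideal Q P" using ass by (simp add: associated_prime_def)
  obtain w where wit: "is_witness Q T act P w"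
    using ass q unfolding associated_prime_def by blast
  define F where "F = carrier Q - P"
  interpret module_loc Q T act F
    using P monoid_module_axioms
    by (simp add: module_loc_def module_loc_axioms_def F_def prime_monoid_ideal_def)
  let ?c = "\<lambda>p. loc_class (carrier Q) (mult Q) F p \<one>"
  let ?t = "loc_class T act F w \<one>"
  obtain G where w: "w \<in> T" and G: "G \<subseteq> carrier Q" "module_span Q (mult Q) G = P"
    and cond: "\<And>p. p \<in> G \<Longrightarrow>
      witness_cond (loc_monoid Q F) (loc_carrier T act F) (loc_act Q T act F) (?c p) ?t"
    using wit unfolding is_witness_def Let_def F_def by blast
  obtain g s where gs: "g \<in> G" "s \<in> carrier Q" "q = s \<otimes> g"
    using q G(2) unfolding module_span_def by blast
  have g: "g \<in> carrier Q" using gs G by blast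
  have inj: "inj_on (act g) T"
    using canc gs g unfolding acts_cancellatively_def inj_on_def by (simp add: act_mult)
  have "x = ?t" if x: "x \<in> loc_carrier T act F"
    and e: "loc_act Q T act F (?c g) x = loc_act Q T act F (?c g) ?t" for x
  proof -
    obtain t f where tf: "t \<in> T" "f \<in> F" "x = loc_class T act F t f"
      using x by (rule loc_carrierE)
    obtain v where v: "v \<in> F" "act v (act g t) = act v (act f (act g w))"
      using e tf g w by (auto simp: loc_act_class loc_class_eq_iff)
    have "act g (act v t) = act g (act v (act f w))"
      using v tf(1,2) g w by (simp add: act_lcomm[of g])
    then have "act v t = act v (act f w)" using inj v(1) tf(1,2) w by (auto dest: inj_onD)
    then show ?thesis using v(1) tf w by (auto simp: loc_class_eq_iff)
  qed
  then have "map_ker (loc_carrier T act F) (loc_act Q T act F (?c g)) `` {?t} = {?t}"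
    using w unfolding map_ker_def by auto
  then show False using cond[OF gs(1)] by (simp add: witness_cond_def)
qed

lemma nilpotent_in_associated_prime:
  assumes ass: "associated_prime Q T act P" and q: "q \<in> carrier Q"
    and nil: "acts_nilpotently Q T act q"
  shows "q \<in> P"
proof (rule ccontr)
  assume "q \<notin> P"
  have P: "prime_monoid_ideal Q P" using ass by (simp add: associated_prime_def)
  define F where "F = carrier Q - P"
  interpret module_loc Q T act F
    using P monoid_module_axioms
    by (simp add: module_loc_def module_loc_axioms_def F_def prime_monoid_ideal_def)
  interpret Q: module_loc Q "carrier Q" "mult Q" F
    using self_module submonoid_F by (simp add: module_loc_def module_loc_axioms_def)
  interpret L: monoid_module "loc_monoid Q F" "loc_carrier T act F" "loc_act Q T act F"
    by (rule monoid_module_loc)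
  have "q \<in> F" using q \<open>q \<notin> P\<close> by (simp add: F_def)
  then have pow: "q [^] n \<in> F" for n :: nat by (induction n) auto
  from ass consider w where "is_witness Q T act P w"
    | s where "s \<in> T"
      "{t \<in> T. equivclp (module_edge Q T act) s t} \<inter> nil_elements Q T act = {}"
    unfolding associated_prime_def module_orbits_def by blast
  then show False
  proof cases
    case (1 w)
    let ?t = "loc_class T act F w \<one>"
    have w: "w \<in> T"
      and nn: "?t \<notin> nil_elements (loc_monoid Q F) (loc_carrier T act F) (loc_act Q T act F)"
      using 1 unfolding is_witness_def Let_def F_def by blast+
    obtain n :: nat where n: "act (q [^] n) w \<in> nil_elements Q T act"
      using nil w unfolding acts_nilpotently_def by blast
    have "loc_act Q T act F r ?t = ?t" if "r \<in> carrier (loc_monoid Q F)" for r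
    proof -
      from that have "r \<in> loc_carrier (carrier Q) (mult Q) F" by (simp add: loc_monoid_def)
      then obtain u f where uf: "u \<in> carrier Q" "f \<in> F" "r = loc_class (carrier Q) (mult Q) F u f"
        by (rule Q.loc_carrierE)
      have "act (q [^] n) (act u w) = act (q [^] n) (act f w)"
        using act_lcomm[of "q [^] n" u w] act_lcomm[of "q [^] n" f w] act_nil[OF n] uf q w by simp
      then show ?thesis using uf w pow[of n] by (auto simp: loc_act_class loc_class_eq_iff)
    qed
    then show False using nn w L.nil_elements_iff by simp
  next
    case (2 s)
    obtain n :: nat where n: "act (q [^] n) s \<in> nil_elements Q T act"
      using nil 2(1) unfolding acts_nilpotently_def by blast
    have "module_edge Q T act s (act (q [^] n) s)"
      using 2(1) q unfolding module_edge_def by auto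
    then have "equivclp (module_edge Q T act) s (act (q [^] n) s)" by (rule r_into_equivclp)
    moreover have "act (q [^] n) s \<in> T" using 2(1) q by simp
    ultimately show False using 2(2) n by blast
  qed
qed

lemma associated_prime_if_not_cancellative:
  assumes noeth: "noetherian_monoid Q" and q: "q \<in> carrier Q"
    and canc: "\<not> acts_cancellatively T act q"
  shows "\<exists>P. associated_prime Q T act P \<and> q \<in> P"
proof -
  define J where "J a b = {r \<in> carrier Q. act r a = act r b}" for a b
  obtain a b where ab: "a \<in> T" "b \<in> T" "a \<noteq> b" "act q a = act q b"
    using canc unfolding acts_cancellatively_def inj_on_def by blast
  let ?\<I> = "{J a b | a b. a \<in> T \<and> b \<in> T \<and> a \<noteq> b}"
  have "J a b \<in> ?\<I>" using ab by blast
  then obtain P where "P \<in> ?\<I>" "J a b \<subseteq> P" and P: "prime_monoid_ideal Q P"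
  proof (rule colon_closed_family_has_prime[OF noeth])
    fix I assume "I \<in> ?\<I>"
    then obtain c d where I: "I = J c d" and cd: "c \<in> T" "d \<in> T" "c \<noteq> d" by blast
    show "monoid_ideal Q I" using cd by (auto simp: I J_def monoid_ideal_def act_mult)
    show "\<one> \<notin> I" using cd by (simp add: I J_def)
    fix r assume r: "r \<in> carrier Q" "r \<notin> I"
    then have "{s \<in> carrier Q. s \<otimes> r \<in> I} = J (act r c) (act r d)"
      using cd by (auto simp: I J_def act_mult)
    moreover have "act r c \<noteq> act r d" using r by (simp add: I J_def)
    moreover have "act r c \<in> T" "act r d \<in> T" using r cd by simp_all
    ultimately show "{s \<in> carrier Q. s \<otimes> r \<in> I} \<in> ?\<I>" by blast
  qed
  then obtain c d where cd: "c \<in> T" "d \<in> T" "P = J c d" by blast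
  have qP: "q \<in> P" using \<open>J a b \<subseteq> P\<close> ab(4) q by (auto simp: J_def)
  have one: "\<one> \<in> carrier Q - P" using P by (auto simp: prime_monoid_ideal_def submonoid_def)
  have "associated_prime Q T act P"
  proof (rule associated_prime_if_identified_pair[OF P _ cd(1,2)])
    show "\<exists>f \<in> carrier Q - P. act f (act p c) = act f (act p d)" if "p \<in> P" for p
      using that one cd(3) by (auto simp: J_def)
  qed (use qP cd(3) in \<open>auto simp: J_def\<close>)
  with qP show ?thesis by blast
qed

text \<open>
  The annihilators are taken modulo powers of \<open>q\<close>, that is, after inverting \<open>q\<close>; this keeps \<open>q\<close>
  out of the prime \<open>P\<close> found.  If \<open>P\<close> is not empty, all elements of \<open>P\<close> send \<open>w\<close>, up to a power
  of \<open>q\<close>, to a nil element, and it is the same one for all of them: nil elements with a common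
  multiple are equal.  If \<open>P\<close> is empty, no multiple of \<open>w\<close> is nil, and then nothing in the orbit
  of \<open>w\<close> is: a nil element there would itself be its common multiple with \<open>w\<close>.
\<close>

lemma associated_prime_if_not_nilpotent:
  assumes noeth: "noetherian_monoid Q" and q: "q \<in> carrier Q"
    and nnil: "\<not> acts_nilpotently Q T act q"
  shows "\<exists>P. associated_prime Q T act P \<and> q \<notin> P"
proof -
  let ?N = "nil_elements Q T act"
  define J where "J w = {r \<in> carrier Q. \<exists>n::nat. act (q [^] n) (act r w) \<in> ?N}" for w
  let ?\<I> = "{J w | w. w \<in> T \<and> (\<forall>n::nat. act (q [^] n) w \<notin> ?N)}"
  obtain t where "t \<in> T" "\<forall>n::nat. act (q [^] n) t \<notin> ?N"
    using nnil unfolding acts_nilpotently_def by blast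
  then have "J t \<in> ?\<I>" by blast
  then obtain P where "P \<in> ?\<I>" and P: "prime_monoid_ideal Q P"
  proof (rule colon_closed_family_has_prime[OF noeth])
    fix I assume "I \<in> ?\<I>"
    then obtain w where I: "I = J w" and w: "w \<in> T" "\<And>n::nat. act (q [^] n) w \<notin> ?N" by blast
    have "u \<otimes> r \<in> I" if ur: "u \<in> carrier Q" "r \<in> I" for u r
    proof -
      obtain n :: nat where n: "r \<in> carrier Q" "act (q [^] n) (act r w) \<in> ?N"
        using ur(2) by (auto simp: I J_def)
      then have "act (q [^] n) (act (u \<otimes> r) w) \<in> ?N"
        using act_in_nil_elements[of "act r w" "q [^] n" u] ur(1) w(1) q by (simp add: act_mult)
      then show ?thesis using n(1) ur(1) by (auto simp: I J_def)
    qed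
    then show "monoid_ideal Q I" by (auto simp: monoid_ideal_def I J_def)
    show "\<one> \<notin> I" using w by (simp add: I J_def)
    fix r assume r: "r \<in> carrier Q" "r \<notin> I"
    then have "{s \<in> carrier Q. s \<otimes> r \<in> I} = J (act r w)"
      using w(1) by (auto simp: I J_def act_mult)
    moreover have "\<forall>n::nat. act (q [^] n) (act r w) \<notin> ?N" using r by (simp add: I J_def)
    moreover have "act r w \<in> T" using r w(1) by simp
    ultimately show "{s \<in> carrier Q. s \<otimes> r \<in> I} \<in> ?\<I>" by blast
  qed
  then obtain w where Pw: "P = J w" and w: "w \<in> T" "\<And>n::nat. act (q [^] n) w \<notin> ?N" by blast
  have pow: "q [^] n \<in> carrier Q - P" for n :: nat
  proof -
    have "act (q [^] m) (act (q [^] n) w) \<notin> ?N" for m :: nat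
      using w(2)[of "m + n"] w(1) q by (simp add: act_mult nat_pow_mult[symmetric])
    then show ?thesis using q by (simp add: Pw J_def)
  qed
  have notnil: "act f w \<notin> ?N" if "f \<in> carrier Q - P" for f
  proof
    assume "act f w \<in> ?N"
    then have "act (q [^] (0::nat)) (act f w) \<in> ?N" using that w(1) by simp
    then show False using that unfolding Pw J_def by blast
  qed
  have "associated_prime Q T act P"
  proof (cases "P = {}")
    case True
    have "z \<notin> ?N" if z: "equivclp (module_edge Q T act) w z" for z
    proof
      assume "z \<in> ?N"
      moreover obtain u r where "u \<in> carrier Q" "r \<in> carrier Q" "act u w = act r z"
        using connected_have_common_multiple[OF z w(1)] by blast
      ultimately show False using notnil[of u] True act_nil by simp
    qed
    then have "{t \<in> T. equivclp (module_edge Q T act) w t} \<inter> ?N = {}" by blast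
    then show ?thesis
      using P True w(1) unfolding associated_prime_def module_orbits_def by blast
  next
    case False
    then obtain p\<^sub>0 and m :: nat
      where p0: "p\<^sub>0 \<in> carrier Q" and z: "act (q [^] m) (act p\<^sub>0 w) \<in> ?N"
      by (auto simp: Pw J_def)
    define z where "z = act (q [^] m) (act p\<^sub>0 w)"
    have zN: "z \<in> ?N" "z \<in> T" using z nil_elements_iff by (auto simp: z_def)
    show ?thesis
    proof (rule associated_prime_if_identified_pair[OF P False w(1) zN(2)])
      show "act f w \<noteq> act f z" if "f \<in> carrier Q - P" for f
        using notnil[OF that] act_nil[OF zN(1)] zN(1) that by auto
      fix p assume "p \<in> P"
      then obtain n :: nat where p: "p \<in> carrier Q" and n: "act (q [^] n) (act p w) \<in> ?N"
        by (auto simp: Pw J_def)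
      have "act (q [^] n) (act p w) = act (q [^] m) (act p\<^sub>0 (act (q [^] n) (act p w)))"
        using act_nil[OF n] p0 q by simp
      also have "\<dots> = act (q [^] n) (act p z)"
        using p p0 q w(1) by (simp add: z_def act_lcomm)
      finally show "\<exists>f \<in> carrier Q - P. act f (act p w) = act f (act p z)" using pow by blast
    qed
  qed
  moreover have "q \<notin> P" using pow[of 1] q by simp
  ultimately show ?thesis by blast
qed

lemma in_some_associated_prime_iff:
  assumes "noetherian_monoid Q" "q \<in> carrier Q"
  shows "(\<exists>P. associated_prime Q T act P \<and> q \<in> P) \<longleftrightarrow> \<not> acts_cancellatively T act q"
  using associated_prime_if_not_cancellative[OF assms] cancellative_notin_associated_prime by blast

lemma in_all_associated_primes_iff:
  assumes "noetherian_monoid Q" "q \<in> carrier Q"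
  shows "(\<forall>P. associated_prime Q T act P \<longrightarrow> q \<in> P) \<longleftrightarrow> acts_nilpotently Q T act q"
  using associated_prime_if_not_nilpotent[OF assms] nilpotent_in_associated_prime assms(2) by blast

end

theorem theorem3p7:
  fixes Q :: "('q, 'm) monoid_scheme"
    and T :: "'t set"
    and act :: "'q \<Rightarrow> 't \<Rightarrow> 't"
  assumes "noetherian_monoid Q"
    and "monoid_module Q T act"
    and "fin_gen_module Q T act"
  shows "primary_module Q T act \<longleftrightarrow> (\<exists>!P. associated_prime Q T act P)"
proof -
  interpret monoid_module Q T act by (rule assms(2))
  let ?ass = "associated_prime Q T act"
  have some: "(\<exists>P. ?ass P \<and> q \<in> P) \<longleftrightarrow> \<not> acts_cancellatively T act q"
    and all: "(\<forall>P. ?ass P \<longrightarrow> q \<in> P) \<longleftrightarrow> acts_nilpotently Q T act q" if "q \<in> carrier Q" for q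
    using in_some_associated_prime_iff in_all_associated_primes_iff assms(1) that by auto
  show ?thesis
  proof
    assume prim: "primary_module Q T act"
    have "acts_cancellatively T act \<one>\<^bsub>Q\<^esub>" by (simp add: acts_cancellatively_def inj_on_def)
    then have "\<not> acts_nilpotently Q T act \<one>\<^bsub>Q\<^esub>" using prim by (auto simp: primary_module_def)
    then have "\<exists>P. ?ass P" using all[OF one_closed] by blast
    moreover have "P = {q \<in> carrier Q. acts_nilpotently Q T act q}" if P: "?ass P" for P
    proof -
      have "P \<subseteq> carrier Q"
        using P by (auto simp: associated_prime_def prime_monoid_ideal_def monoid_ideal_def)
      then show ?thesis using P some all prim unfolding primary_module_def by blast
    qed
    ultimately show "\<exists>!P. ?ass P" by metis
  next
    assume "\<exists>!P. ?ass P"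
    then obtain P where "?ass P" "\<And>P'. ?ass P' \<Longrightarrow> P' = P" by blast
    then show "primary_module Q T act" using some all unfolding primary_module_def by blast
  qed
qed

end
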